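(* Let $a,b$ be real numbers with $0<b<a$. Then $$\int_{0}^{b} \frac{\ln x \, dx}{\sqrt{(a^{2}-x^{2})(b^{2}-x^{2})}} = \frac{1}{2a}\left[ \mathbf{K}\left(\frac{b}{a}\right)\ln(ab) - \frac{\pi}{2}\,\mathbf{K}\left(\frac{\sqrt{a^{2}-b^{2}}}{a}\right)\right].$$
   Context: $\mathbf{K}$ denotes the complete elliptic integral of the first kind as a function of the modulus $k$: $\mathbf{K}(k)=\int_{0}^{1}\frac{dx}{\sqrt{(1-x^{2})(1-k^{2}x^{2})}}$ for $0\le k<1$. *)

theory Defs
  imports "HOL-Analysis.Analysis"
begin

text \<open>
  The argument is the modulus \<open>k\<close>, not the parameter \<open>m = k\<^sup>2\<close>; meant for \<open>0 \<le> k < 1\<close>.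
  The integral is improper at \<open>1\<close>, so it is taken as a gauge integral over the open interval.
\<close>

definition elliptic_K :: "real \<Rightarrow> real" where
  "elliptic_K k = integral {0<..<1} (\<lambda>x. 1 / sqrt ((1 - x\<^sup>2) * (1 - k\<^sup>2 * x\<^sup>2)))"

end

theory Submission
  imports Defs
begin

text \<open>
  Put \<open>p = a b\<close> and let \<open>0 < x < b\<close>. By partial fractions
  \<open>ln p - 2 ln x\<close> is the integral over \<open>y > 0\<close> of
  \<open>(p\<^sup>2 - x\<^sup>4) y / ((x\<^sup>2 + y\<^sup>2) (x\<^sup>2 y\<^sup>2 + p\<^sup>2))\<close>. Divide by
  \<open>w(x) = sqrt ((a\<^sup>2 - x\<^sup>2) (b\<^sup>2 - x\<^sup>2))\<close>, integrate over \<open>x\<close> and exchange the order of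
  integration, which is allowed since everything is nonnegative. The substitution \<open>v = w(x) / x\<close>
  turns the inner integral over \<open>x\<close> into that of \<open>y / (y\<^sup>2 v\<^sup>2 + D\<^sup>2)\<close> over \<open>v > 0\<close>, where
  \<open>D\<^sup>2 = (a\<^sup>2 + y\<^sup>2) (b\<^sup>2 + y\<^sup>2)\<close>, that is, into \<open>pi / (2 D)\<close>. The remaining integral of
  \<open>1 / D\<close> over \<open>y\<close> is the complementary elliptic integral.
\<close>

section \<open>Nonnegative integrals over open intervals: antiderivatives, substitution, gauge
  integral\<close>

lemma nn_integral_FTC_einterval:
  fixes f F :: "real \<Rightarrow> real" and a b :: ereal
  assumes "a < b"
    and F: "\<And>x. a < ereal x \<Longrightarrow> ereal x < b \<Longrightarrow> (F has_real_derivative f x) (at x)"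
    and f: "\<And>x. a < ereal x \<Longrightarrow> ereal x < b \<Longrightarrow> isCont f x"
    and nonneg: "\<And>x. a < ereal x \<Longrightarrow> ereal x < b \<Longrightarrow> 0 \<le> f x"
    and A: "((F \<circ> real_of_ereal) \<longlongrightarrow> A) (at_right a)"
    and B: "((F \<circ> real_of_ereal) \<longlongrightarrow> B) (at_left b)"
  shows "(\<integral>\<^sup>+x\<in>einterval a b. ennreal (f x) \<partial>lborel) = ennreal (B - A)"
proof -
  \<comment> \<open>For a nonnegative integrand, integrability is a conclusion of the fundamental
    theorem and not a premise; this is what lets the value pass to the integral in
    \<open>ennreal\<close>.\<close>
  have "set_integrable lborel (einterval a b) f" "(LBINT x=a..b. f x) = B - A"
    using interval_integral_FTC_nonneg[OF \<open>a < b\<close> F f _ A B] nonneg by auto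
  then show ?thesis
    using \<open>a < b\<close> nonneg
    by (subst nn_integral_set_ennreal, subst nn_integral_eq_integral)
       (auto simp: set_integrable_def interval_lebesgue_integral_le_eq set_lebesgue_integral_def
          einterval_iff indicator_def mult.commute intro!: AE_I2)
qed

text \<open>The substitution rule for interval integrals needs the transformed integrand to be
  integrable. Here this follows from its nonnegativity and its finite value \<open>r\<close>, so a
  single computation on the side of \<open>g\<close> gives both existence and value on the other
  side.\<close>

lemma nn_integral_substitution_einterval:
  fixes f g g' :: "real \<Rightarrow> real" and a b A B :: ereal
  assumes "a < b" "A < B"
    and "\<And>x. a < ereal x \<Longrightarrow> ereal x < b \<Longrightarrow> (g has_real_derivative g' x) (at x)"
    and "\<And>x. a < ereal x \<Longrightarrow> ereal x < b \<Longrightarrow> isCont f (g x)"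
    and "\<And>x. a < ereal x \<Longrightarrow> ereal x < b \<Longrightarrow> isCont g' x"
    and f: "\<And>x. 0 \<le> f x"
    and g': "\<And>x. a \<le> ereal x \<Longrightarrow> ereal x \<le> b \<Longrightarrow> 0 \<le> g' x"
    and "((ereal \<circ> g \<circ> real_of_ereal) \<longlongrightarrow> A) (at_right a)"
    and "((ereal \<circ> g \<circ> real_of_ereal) \<longlongrightarrow> B) (at_left b)"
    and [measurable]: "(\<lambda>x. f (g x) * g' x) \<in> borel_measurable borel"
    and r: "(\<integral>\<^sup>+x\<in>einterval a b. ennreal (f (g x) * g' x) \<partial>lborel) = ennreal r" "0 \<le> r"
  shows "(\<integral>\<^sup>+y\<in>einterval A B. ennreal (f y) \<partial>lborel) = ennreal r"
proof -
  have "has_bochner_integral lborel (\<lambda>x. indicator (einterval a b) x * (f (g x) * g' x)) r"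
  proof (rule has_bochner_integral_nn_integral)
    show "AE x in lborel. 0 \<le> indicator (einterval a b) x * (f (g x) * g' x)"
      using f g' by (intro AE_I2) (auto simp: indicator_def einterval_iff intro!: mult_nonneg_nonneg)
    show "(\<integral>\<^sup>+x. ennreal (indicator (einterval a b) x * (f (g x) * g' x)) \<partial>lborel) = ennreal r"
      using r(1) unfolding nn_integral_set_ennreal by (simp only: mult.commute)
  qed (use r in simp_all)
  then have i: "set_integrable lborel (einterval a b) (\<lambda>x. f (g x) * g' x)"
    and "(LBINT x=a..b. f (g x) * g' x) = r"
    using \<open>a < b\<close>
    by (auto simp: has_bochner_integral_iff set_integrable_def set_lebesgue_integral_def
        interval_lebesgue_integral_le_eq)
  moreover have "set_integrable lborel (einterval A B) f"
      "(LBINT x=A..B. f x) = (LBINT x=a..b. f (g x) * g' x)"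
    by (rule interval_integral_substitution_nonneg[where g = g and g' = g', OF assms(1,3-5)];
        use assms i in auto)+
  ultimately show ?thesis
    using \<open>A < B\<close> f
    by (subst nn_integral_set_ennreal, subst nn_integral_eq_integral)
       (auto simp: set_integrable_def interval_lebesgue_integral_le_eq set_lebesgue_integral_def
          mult.commute)
qed

text \<open>Bridge from integrals in \<open>ennreal\<close>, where bounds and exchanges of order are
  made, to the gauge integral used by \<open>elliptic_K\<close> and by the theorem.\<close>

lemma has_integral_nn_integral:
  fixes f :: "real \<Rightarrow> real"
  assumes [measurable]: "f \<in> borel_measurable borel" "S \<in> sets borel"
    and "\<And>x. x \<in> S \<Longrightarrow> 0 \<le> f x" "0 \<le> r" "(\<integral>\<^sup>+x\<in>S. ennreal (f x) \<partial>lborel) = ennreal r"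
  shows "(f has_integral r) S"
proof -
  have "((\<lambda>x. if x \<in> S then f x else 0) has_integral r) UNIV"
  proof (rule nn_integral_has_integral)
    have "(\<integral>\<^sup>+x. ennreal (if x \<in> S then f x else 0) \<partial>lborel) = (\<integral>\<^sup>+x\<in>S. ennreal (f x) \<partial>lborel)"
      by (intro nn_integral_cong) auto
    with assms show "(\<integral>\<^sup>+x. ennreal (if x \<in> S then f x else 0) \<partial>lborel) = ennreal r"
      by simp
  qed (use assms in auto)
  then show ?thesis
    by (simp add: has_integral_restrict_UNIV)
qed

section \<open>The complete elliptic integral and its forms with parameters a and b\<close>

lemma elliptic_K_integrand_bounds:
  fixes k x :: real
  assumes "\<bar>k\<bar> < 1" "0 < x" "x < 1"
  shows "0 < 1 - x\<^sup>2" "0 < 1 - k\<^sup>2 * x\<^sup>2" "1 - k\<^sup>2 \<le> 1 - k\<^sup>2 * x\<^sup>2" "0 < 1 - k\<^sup>2"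
proof -
  have "x\<^sup>2 < 1" "k\<^sup>2 < 1"
    using assms by (auto simp: abs_square_less_1)
  then show "0 < 1 - x\<^sup>2" "0 < 1 - k\<^sup>2" "1 - k\<^sup>2 \<le> 1 - k\<^sup>2 * x\<^sup>2"
    using mult_left_mono[of "x\<^sup>2" 1 "k\<^sup>2"] by auto
  then show "0 < 1 - k\<^sup>2 * x\<^sup>2"
    by linarith
qed

text \<open>A gauge \<open>integral\<close> is 0 when the function is not integrable, so finiteness
  has to come first. As x^2 < 1, the factor 1 - k^2 x^2 is at least 1 - k^2, and the integrand is
  dominated by the constant \<open>?c\<close> times the derivative of \<open>arcsin\<close>, which
  has a finite integral over (0, 1).\<close>

lemma nn_integral_elliptic_K:
  assumes "\<bar>k\<bar> < 1"
  shows "(\<integral>\<^sup>+x\<in>{0<..<1}. ennreal (1 / sqrt ((1 - x\<^sup>2) * (1 - k\<^sup>2 * x\<^sup>2))) \<partial>lborel)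
         = ennreal (elliptic_K k)"
    and "0 \<le> elliptic_K k"
proof -
  let ?f = "\<lambda>x. 1 / sqrt ((1 - x\<^sup>2) * (1 - k\<^sup>2 * x\<^sup>2))"
  let ?c = "1 / sqrt (1 - k\<^sup>2)"
  note pos = elliptic_K_integrand_bounds[OF assms]
  have "(\<integral>\<^sup>+x\<in>{0<..<1}. ennreal (?f x) \<partial>lborel)
      \<le> (\<integral>\<^sup>+x\<in>einterval (ereal 0) (ereal 1). ennreal (?c * (1 / sqrt (1 - x\<^sup>2))) \<partial>lborel)"
  proof (intro nn_integral_mono)
    fix x :: real
    show "ennreal (?f x) * indicator {0<..<1} x
        \<le> ennreal (?c * (1 / sqrt (1 - x\<^sup>2))) * indicator (einterval (ereal 0) (ereal 1)) x"
    proof (cases "0 < x \<and> x < 1")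
      case True
      then have "sqrt (1 - k\<^sup>2) * sqrt (1 - x\<^sup>2) \<le> sqrt ((1 - x\<^sup>2) * (1 - k\<^sup>2 * x\<^sup>2))"
        using pos[of x] by (simp add: real_sqrt_mult mult_right_mono mult.commute)
      moreover have "0 < sqrt (1 - k\<^sup>2) * sqrt (1 - x\<^sup>2)"
        using True pos[of x] by simp
      ultimately have "?f x \<le> ?c * (1 / sqrt (1 - x\<^sup>2))"
        by (simp add: frac_le)
      then show ?thesis
        using True by (simp add: ennreal_leI)
    qed auto
  qed
  also have "\<dots> = ennreal (?c * arcsin 1 - ?c * arcsin 0)"
  proof (rule nn_integral_FTC_einterval[where F = "\<lambda>x. ?c * arcsin x"])
    fix x assume "ereal 0 < ereal x" "ereal x < ereal 1"
    then have x: "0 < x" "x < 1" by auto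
    show "((\<lambda>x. ?c * arcsin x) has_real_derivative ?c * (1 / sqrt (1 - x\<^sup>2))) (at x)"
      using x DERIV_arcsin[of x] by (intro DERIV_cmult) (simp add: divide_inverse)
    show "isCont (\<lambda>x. ?c * (1 / sqrt (1 - x\<^sup>2))) x"
      using pos[OF x] by (intro continuous_intros) auto
    show "0 \<le> ?c * (1 / sqrt (1 - x\<^sup>2))"
      using pos[OF x] by simp
  next
    show "(((\<lambda>x. ?c * arcsin x) \<circ> real_of_ereal) \<longlongrightarrow> ?c * arcsin 0) (at_right (ereal 0))"
      unfolding ereal_tendsto_simps1
      using isCont_arcsin[of 0]
      by (intro tendsto_mult tendsto_const) (auto simp: isCont_def intro: tendsto_within_subset)
    \<comment> \<open>The point 1 is the edge of the domain of \<open>arcsin\<close>, so one-sided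
      continuity has to provide the limit.\<close>
    have "continuous (at 1 within {-1..1}) arcsin"
      using continuous_on_arcsin' by (simp add: continuous_on_eq_continuous_within)
    then have "(arcsin \<longlongrightarrow> arcsin 1) (at 1 within {-1..1})"
      by (simp add: continuous_within)
    then have "(arcsin \<longlongrightarrow> arcsin 1) (at_left 1)"
      by (simp add: at_within_Icc_at_left)
    then show "(((\<lambda>x. ?c * arcsin x) \<circ> real_of_ereal) \<longlongrightarrow> ?c * arcsin 1) (at_left (ereal 1))"
      unfolding ereal_tendsto_simps1 by (intro tendsto_mult tendsto_const)
  qed auto
  finally have "(\<integral>\<^sup>+x\<in>{0<..<1}. ennreal (?f x) \<partial>lborel) < \<infinity>"
    using le_less_trans by fastforce
  then obtain r where r: "0 \<le> r" "(\<integral>\<^sup>+x\<in>{0<..<1}. ennreal (?f x) \<partial>lborel) = ennreal r"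
    by (cases "\<integral>\<^sup>+x\<in>{0<..<1}. ennreal (?f x) \<partial>lborel") auto
  have "(?f has_integral r) {0<..<1}"
    using r pos by (intro has_integral_nn_integral) (auto intro!: mult_nonneg_nonneg less_imp_le)
  then have "elliptic_K k = r"
    unfolding elliptic_K_def by (rule integral_unique)
  with r show "(\<integral>\<^sup>+x\<in>{0<..<1}. ennreal (?f x) \<partial>lborel) = ennreal (elliptic_K k)"
    "0 \<le> elliptic_K k"
    by auto
qed

text \<open>Rescaling the variable by b pulls (a b)^2 out of the radicand; together with dx = b dt
  this leaves the factor 1 / a and the modulus b / a.\<close>

lemma has_integral_elliptic_K_scaled:
  fixes a b :: real
  assumes "0 < b" "b < a"
  shows "((\<lambda>x. 1 / sqrt ((a\<^sup>2 - x\<^sup>2) * (b\<^sup>2 - x\<^sup>2))) has_integral elliptic_K (b / a) / a) {0<..<b}"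
proof -
  \<comment> \<open>The absolute value makes the integrand nonnegative on the whole line:
    \<open>sqrt\<close> of a negative number is negative.\<close>
  let ?f = "\<lambda>x. 1 / sqrt \<bar>(a\<^sup>2 - x\<^sup>2) * (b\<^sup>2 - x\<^sup>2)\<bar>"
  have k: "\<bar>b / a\<bar> < 1"
    using assms by simp
  have "(\<integral>\<^sup>+x\<in>einterval (ereal 0) (ereal b). ennreal (?f x) \<partial>lborel) = ennreal (elliptic_K (b / a) / a)"
  proof (rule nn_integral_substitution_einterval[where g = "\<lambda>x. b * x" and g' = "\<lambda>_. b" and a = 0 and b = 1])
    fix x assume "(0::ereal) < ereal x" "ereal x < 1"
    then have x: "0 < x" "x < 1" by auto
    then have "(b * x)\<^sup>2 < b\<^sup>2" "b\<^sup>2 < a\<^sup>2"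
      using assms by (auto intro!: power_strict_mono)
    then show "isCont ?f (b * x)"
      by (intro continuous_intros) auto
  next
    have "(\<integral>\<^sup>+x\<in>einterval 0 1. ennreal (?f (b * x) * b) \<partial>lborel)
      = (\<integral>\<^sup>+x. ennreal (1 / a) * (ennreal (1 / sqrt ((1 - x\<^sup>2) * (1 - (b / a)\<^sup>2 * x\<^sup>2)))
          * indicator {0<..<1} x) \<partial>lborel)"
    proof (intro nn_integral_cong)
      fix x :: real
      have "?f (b * x) * b = 1 / a * (1 / sqrt ((1 - x\<^sup>2) * (1 - (b / a)\<^sup>2 * x\<^sup>2)))"
        if "0 < x" "x < 1"
      proof -
        have "(a\<^sup>2 - (b * x)\<^sup>2) * (b\<^sup>2 - (b * x)\<^sup>2) = (a * b)\<^sup>2 * ((1 - x\<^sup>2) * (1 - (b / a)\<^sup>2 * x\<^sup>2))"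
          using assms by (simp add: field_simps power2_eq_square)
        then have "sqrt \<bar>(a\<^sup>2 - (b * x)\<^sup>2) * (b\<^sup>2 - (b * x)\<^sup>2)\<bar>
            = a * b * sqrt ((1 - x\<^sup>2) * (1 - (b / a)\<^sup>2 * x\<^sup>2))"
          using assms elliptic_K_integrand_bounds[OF k that]
          by (simp only: abs_mult real_sqrt_mult abs_of_pos real_sqrt_abs abs_power2)
        then show ?thesis
          using assms by simp
      qed
      then show "ennreal (?f (b * x) * b) * indicator (einterval 0 1) x = ennreal (1 / a) *
          (ennreal (1 / sqrt ((1 - x\<^sup>2) * (1 - (b / a)\<^sup>2 * x\<^sup>2))) * indicator {0<..<1} x)"
        using assms elliptic_K_integrand_bounds[OF k, of x]
        by (auto simp: indicator_def einterval_iff ennreal_mult'[symmetric])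
    qed
    also have "\<dots> = ennreal (1 / a) * ennreal (elliptic_K (b / a))"
      by (subst nn_integral_cmult) (auto simp: nn_integral_elliptic_K[OF k])
    also have "\<dots> = ennreal (elliptic_K (b / a) / a)"
      using assms nn_integral_elliptic_K[OF k] by (simp add: ennreal_mult'[symmetric])
    finally show "(\<integral>\<^sup>+x\<in>einterval 0 1. ennreal (?f (b * x) * b) \<partial>lborel)
      = ennreal (elliptic_K (b / a) / a)" .
  next
    have "((\<lambda>x. b * x) \<longlongrightarrow> b * 0) (at_right 0)" "((\<lambda>x. b * x) \<longlongrightarrow> b * 1) (at_left 1)"
      by (intro tendsto_intros)+
    then show "((ereal \<circ> (\<lambda>x. b * x) \<circ> real_of_ereal) \<longlongrightarrow> ereal 0) (at_right 0)"
      "((ereal \<circ> (\<lambda>x. b * x) \<circ> real_of_ereal) \<longlongrightarrow> ereal b) (at_left 1)"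
      unfolding zero_ereal_def one_ereal_def ereal_tendsto_simps1 by (simp_all add: comp_def)
  qed (use assms nn_integral_elliptic_K[OF k] in \<open>auto intro!: derivative_eq_intros\<close>)
  then have "(?f has_integral elliptic_K (b / a) / a) {0<..<b}"
    using assms nn_integral_elliptic_K[OF k] by (intro has_integral_nn_integral) auto
  then show ?thesis
  proof (rule has_integral_eq[rotated])
    fix x assume "x \<in> {0<..<b}"
    then have "x\<^sup>2 < b\<^sup>2" "b\<^sup>2 < a\<^sup>2"
      using assms by (auto intro!: power_strict_mono)
    then have "0 \<le> (a\<^sup>2 - x\<^sup>2) * (b\<^sup>2 - x\<^sup>2)"
      by (intro mult_nonneg_nonneg) auto
    then show "?f x = 1 / sqrt ((a\<^sup>2 - x\<^sup>2) * (b\<^sup>2 - x\<^sup>2))"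
      by (simp only: abs_of_nonneg)
  qed
qed

text \<open>Substitute y = b x / sqrt (1 - x^2). Then b^2 + y^2 = b^2 / (1 - x^2) and a^2 + y^2 =
  a^2 (1 - k^2 x^2) / (1 - x^2), where k^2 = 1 - (b / a)^2, so the modulus is the one complementary
  to b / a. The powers of 1 - x^2 combine with the derivative of the substitution to the integrand
  of \<open>elliptic_K k\<close>, up to the factor 1 / a.\<close>

lemma nn_integral_elliptic_K_complementary:
  fixes a b :: real
  assumes "0 < b" "b < a"
  shows "(\<integral>\<^sup>+y\<in>{0<..}. ennreal (1 / sqrt ((a\<^sup>2 + y\<^sup>2) * (b\<^sup>2 + y\<^sup>2))) \<partial>lborel)
         = ennreal (elliptic_K (sqrt (a\<^sup>2 - b\<^sup>2) / a) / a)"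
proof -
  let ?f = "\<lambda>y. 1 / sqrt ((a\<^sup>2 + y\<^sup>2) * (b\<^sup>2 + y\<^sup>2))"
  define k where "k = sqrt (a\<^sup>2 - b\<^sup>2) / a"
  \<comment> \<open>With x = sin t this is y = b tan t, an increasing map of (0, 1) onto the
    positive half-line.\<close>
  define g where "g x = b * x / sqrt (1 - x\<^sup>2)" for x
  define g' where "g' x = b / ((1 - x\<^sup>2) * sqrt (1 - x\<^sup>2))" for x
  have "b\<^sup>2 < a\<^sup>2"
    using assms by (auto intro!: power_strict_mono)
  then have k2: "k\<^sup>2 = (a\<^sup>2 - b\<^sup>2) / a\<^sup>2"
    by (simp add: k_def power_divide)
  then have "k\<^sup>2 < 1"
    using assms by simp
  then have k: "\<bar>k\<bar> < 1"
    by (simp add: abs_square_less_1)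
  have "(\<integral>\<^sup>+y\<in>einterval (ereal 0) \<infinity>. ennreal (?f y) \<partial>lborel) = ennreal (elliptic_K k / a)"
  proof (rule nn_integral_substitution_einterval[where g = g and g' = g' and a = 0 and b = 1])
    fix x assume "(0::ereal) < ereal x" "ereal x < 1"
    then have x: "0 < x" "x < 1" by auto
    note pos = elliptic_K_integrand_bounds[OF k x]
    show "isCont ?f (g x)"
      using assms by (intro continuous_intros) (simp add: add_pos_nonneg less_imp_neq[symmetric])
    show "isCont g' x"
      unfolding g'_def using pos by (intro continuous_intros) auto
    have "((\<lambda>x. sqrt (1 - x\<^sup>2)) has_real_derivative inverse (sqrt (1 - x\<^sup>2)) / 2 * (- (2 * x))) (at x)"
      using pos by (intro DERIV_chain2[OF DERIV_real_sqrt]) (auto intro!: derivative_eq_intros)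
    from DERIV_divide[OF DERIV_cmult[OF DERIV_ident] this, of b]
    show "(g has_real_derivative g' x) (at x)"
      unfolding g_def [abs_def]
    proof (rule DERIV_cong)
      show "(b * 1 * sqrt (1 - x\<^sup>2) - b * x * (inverse (sqrt (1 - x\<^sup>2)) / 2 * (- (2 * x))))
          / (sqrt (1 - x\<^sup>2) * sqrt (1 - x\<^sup>2)) = g' x"
        unfolding g'_def using pos
        by (simp add: divide_simps) (simp add: algebra_simps power2_eq_square)
    qed (use pos in simp)
  next
    \<comment> \<open>The substitution lemma asks for the sign of \<open>g'\<close> at the endpoints
      too; at 1 the denominator vanishes and division by zero gives the value 0.\<close>
    fix x assume "(0::ereal) \<le> ereal x" "ereal x \<le> 1"
    then have "x\<^sup>2 \<le> 1"
      by (simp add: abs_square_le_1)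
    then show "0 \<le> g' x"
      unfolding g'_def using assms by simp
  next
    have "(\<integral>\<^sup>+x\<in>einterval 0 1. ennreal (?f (g x) * g' x) \<partial>lborel)
      = (\<integral>\<^sup>+x. ennreal (1 / a) * (ennreal (1 / sqrt ((1 - x\<^sup>2) * (1 - k\<^sup>2 * x\<^sup>2)))
          * indicator {0<..<1} x) \<partial>lborel)"
    proof (intro nn_integral_cong)
      fix x :: real
      have "?f (g x) * g' x = 1 / a * (1 / sqrt ((1 - x\<^sup>2) * (1 - k\<^sup>2 * x\<^sup>2)))"
        if x: "0 < x" "x < 1"
      proof -
        note pos = elliptic_K_integrand_bounds[OF k x]
        have "(g x)\<^sup>2 = b\<^sup>2 * x\<^sup>2 / (1 - x\<^sup>2)"
          using pos by (simp add: g_def power_divide power_mult_distrib)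
        then have "a\<^sup>2 + (g x)\<^sup>2 = a\<^sup>2 * (1 - k\<^sup>2 * x\<^sup>2) / (1 - x\<^sup>2)" "b\<^sup>2 + (g x)\<^sup>2 = b\<^sup>2 / (1 - x\<^sup>2)"
          unfolding k2 using pos assms by (simp_all add: divide_simps) (simp_all add: algebra_simps)
        then have "(a\<^sup>2 + (g x)\<^sup>2) * (b\<^sup>2 + (g x)\<^sup>2) = (a * b / (1 - x\<^sup>2))\<^sup>2 * (1 - k\<^sup>2 * x\<^sup>2)"
          by (simp add: power_divide power_mult_distrib power2_eq_square)
        then have "sqrt ((a\<^sup>2 + (g x)\<^sup>2) * (b\<^sup>2 + (g x)\<^sup>2)) = a * b / (1 - x\<^sup>2) * sqrt (1 - k\<^sup>2 * x\<^sup>2)"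
          using pos assms by (simp add: real_sqrt_mult)
        then show ?thesis
          using assms pos by (simp add: g'_def real_sqrt_mult)
      qed
      then show "ennreal (?f (g x) * g' x) * indicator (einterval 0 1) x = ennreal (1 / a) *
          (ennreal (1 / sqrt ((1 - x\<^sup>2) * (1 - k\<^sup>2 * x\<^sup>2))) * indicator {0<..<1} x)"
        using assms elliptic_K_integrand_bounds[OF k, of x]
        by (auto simp: indicator_def einterval_iff ennreal_mult'[symmetric])
    qed
    also have "\<dots> = ennreal (1 / a) * ennreal (elliptic_K k)"
      by (subst nn_integral_cmult) (auto simp: nn_integral_elliptic_K[OF k])
    also have "\<dots> = ennreal (elliptic_K k / a)"
      using assms nn_integral_elliptic_K[OF k] by (simp add: ennreal_mult'[symmetric])
    finally show "(\<integral>\<^sup>+x\<in>einterval 0 1. ennreal (?f (g x) * g' x) \<partial>lborel) = ennreal (elliptic_K k / a)" .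
  next
    have "(g \<longlongrightarrow> g 0) (at_right 0)"
      unfolding g_def [abs_def] by (auto intro!: tendsto_eq_intros)
    then show "((ereal \<circ> g \<circ> real_of_ereal) \<longlongrightarrow> ereal 0) (at_right 0)"
      unfolding zero_ereal_def ereal_tendsto_simps1 by (simp add: g_def [of 0] comp_def)
  next
    have "filterlim g at_top (at_left 1)"
      unfolding g_def [abs_def]
    proof (rule LIM_at_top_divide)
      show "((\<lambda>x. b * x) \<longlongrightarrow> b * 1) (at_left 1)"
        by (intro tendsto_intros)
      show "((\<lambda>x. sqrt (1 - x\<^sup>2)) \<longlongrightarrow> 0) (at_left 1)"
        by (auto intro!: tendsto_eq_intros)
      have "\<forall>\<^sub>F x in at_left 1. x \<in> {0<..<(1::real)}"
        by (rule eventually_at_leftI[of 0]) auto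
      then show "\<forall>\<^sub>F x in at_left 1. 0 < sqrt (1 - x\<^sup>2)"
        by eventually_elim (use elliptic_K_integrand_bounds[OF k] in auto)
    qed (use assms in simp)
    then show "((ereal \<circ> g \<circ> real_of_ereal) \<longlongrightarrow> \<infinity>) (at_left 1)"
      unfolding one_ereal_def ereal_tendsto_simps1 by (simp add: comp_def tendsto_PInfty_eq_at_top)
  next
    show "(\<lambda>x. ?f (g x) * g' x) \<in> borel_measurable borel"
      unfolding g_def g'_def by measurable
  qed (use assms nn_integral_elliptic_K[OF k] in auto)
  then show ?thesis
    by (simp add: k_def)
qed

section \<open>The kernel integrated over y and over x\<close>

lemma nn_integral_log_kernel:
  fixes x p :: real
  assumes "0 < x" and "x\<^sup>2 < p"
  shows "(\<integral>\<^sup>+y\<in>{0<..}. ennreal ((p\<^sup>2 - x ^ 4) * y / ((x\<^sup>2 + y\<^sup>2) * (x\<^sup>2 * y\<^sup>2 + p\<^sup>2))) \<partial>lborel)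
         = ennreal (ln p - 2 * ln x)"
proof -
  have p: "0 < p" using assms by (smt (verit) zero_le_power2)
  have xp: "x ^ 4 \<le> p\<^sup>2"
    using power_mono[of "x\<^sup>2" p 2] assms by simp
  have pos: "0 < x\<^sup>2 + y\<^sup>2" "0 < x\<^sup>2 * y\<^sup>2 + p\<^sup>2" for y
    using assms(1) p by (simp_all add: add_pos_nonneg add_nonneg_pos)
  \<comment> \<open>The integrand splits into y / (x^2 + y^2) - x^2 y / (x^2 y^2 + p^2), and
    \<open>?F\<close> integrates both fractions.\<close>
  let ?F = "\<lambda>y. (ln (x\<^sup>2 + y\<^sup>2) - ln (x\<^sup>2 * y\<^sup>2 + p\<^sup>2)) / 2"
  have "(\<integral>\<^sup>+y\<in>einterval (ereal 0) \<infinity>.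
          ennreal ((p\<^sup>2 - x ^ 4) * y / ((x\<^sup>2 + y\<^sup>2) * (x\<^sup>2 * y\<^sup>2 + p\<^sup>2))) \<partial>lborel)
        = ennreal (- ln x - (ln x - ln p))"
  proof (rule nn_integral_FTC_einterval[where F = ?F])
    fix y
    have "(?F has_real_derivative
            ((2 * y) / (x\<^sup>2 + y\<^sup>2) - (x\<^sup>2 * (2 * y)) / (x\<^sup>2 * y\<^sup>2 + p\<^sup>2)) / 2) (at y)"
      using pos[of y] by (auto intro!: derivative_eq_intros)
    also have "((2 * y) / (x\<^sup>2 + y\<^sup>2) - (x\<^sup>2 * (2 * y)) / (x\<^sup>2 * y\<^sup>2 + p\<^sup>2)) / 2 =
      (p\<^sup>2 - x ^ 4) * y / ((x\<^sup>2 + y\<^sup>2) * (x\<^sup>2 * y\<^sup>2 + p\<^sup>2))"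
      using pos[of y] by (simp add: divide_simps) (simp add: algebra_simps power_numeral_reduce)
    finally show "(?F has_real_derivative
        (p\<^sup>2 - x ^ 4) * y / ((x\<^sup>2 + y\<^sup>2) * (x\<^sup>2 * y\<^sup>2 + p\<^sup>2))) (at y)" .
    show "isCont (\<lambda>y. (p\<^sup>2 - x ^ 4) * y / ((x\<^sup>2 + y\<^sup>2) * (x\<^sup>2 * y\<^sup>2 + p\<^sup>2))) y"
      using pos[of y] by (intro continuous_intros) auto
    assume "ereal 0 < ereal y"
    then show "0 \<le> (p\<^sup>2 - x ^ 4) * y / ((x\<^sup>2 + y\<^sup>2) * (x\<^sup>2 * y\<^sup>2 + p\<^sup>2))"
      using xp pos[of y] by simp
  next
    have "isCont ?F 0"
      using pos[of 0] by (intro continuous_intros) auto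
    then have "(?F \<longlongrightarrow> ?F 0) (at_right 0)"
      by (auto simp: isCont_def intro: tendsto_within_subset)
    moreover have "?F 0 = ln x - ln p"
      using assms p by (simp add: ln_realpow)
    ultimately show "((?F \<circ> real_of_ereal) \<longlongrightarrow> ln x - ln p) (at_right (ereal 0))"
      by (simp only: ereal_tendsto_simps1)
  next
    \<comment> \<open>Each logarithm diverges, so they are joined into the logarithm of a quotient.
      That quotient is 1 / x^2 plus a constant divided by x^2 y^2 + p^2, hence tends to 1 /
      x^2.\<close>
    have "(?F \<longlongrightarrow> - ln x) at_top"
    proof (rule Lim_transform_eventually)
      have "((\<lambda>y. (x\<^sup>2 + y\<^sup>2) / (x\<^sup>2 * y\<^sup>2 + p\<^sup>2)) \<longlongrightarrow> 1 / x\<^sup>2) at_top"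
      proof -
        have "filterlim (\<lambda>y. x\<^sup>2 * y\<^sup>2 + p\<^sup>2) at_top at_top"
          using assms(1)
          by (subst add.commute, intro filterlim_tendsto_add_at_top[OF tendsto_const]
              filterlim_tendsto_pos_mult_at_top[OF tendsto_const] filterlim_pow_at_top
              filterlim_ident) auto
        then have "((\<lambda>y. 1 / x\<^sup>2 + (x\<^sup>2 - p\<^sup>2 / x\<^sup>2) / (x\<^sup>2 * y\<^sup>2 + p\<^sup>2)) \<longlongrightarrow> 1 / x\<^sup>2 + 0) at_top"
          by (intro tendsto_add tendsto_const tendsto_divide_0[OF tendsto_const]
              filterlim_at_top_imp_at_infinity)
        moreover have "1 / x\<^sup>2 + (x\<^sup>2 - p\<^sup>2 / x\<^sup>2) / (x\<^sup>2 * y\<^sup>2 + p\<^sup>2)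
            = (x\<^sup>2 + y\<^sup>2) / (x\<^sup>2 * y\<^sup>2 + p\<^sup>2)" for y
          using assms(1) pos(2)[of y] by (simp add: divide_simps) (simp add: algebra_simps)
        ultimately show ?thesis
          by simp
      qed
      then have "((\<lambda>y. ln ((x\<^sup>2 + y\<^sup>2) / (x\<^sup>2 * y\<^sup>2 + p\<^sup>2)) / 2) \<longlongrightarrow> ln (1 / x\<^sup>2) / 2) at_top"
        using assms(1) by (intro tendsto_divide[OF tendsto_ln tendsto_const]) auto
      also have "ln (1 / x\<^sup>2) / 2 = - ln x"
        using assms by (simp add: ln_div ln_realpow)
      finally show "((\<lambda>y. ln ((x\<^sup>2 + y\<^sup>2) / (x\<^sup>2 * y\<^sup>2 + p\<^sup>2)) / 2) \<longlongrightarrow> - ln x) at_top" .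
      show "\<forall>\<^sub>F y in at_top. ln ((x\<^sup>2 + y\<^sup>2) / (x\<^sup>2 * y\<^sup>2 + p\<^sup>2)) / 2 = ?F y"
        using assms(1) by (intro always_eventually allI) (simp add: ln_div pos pos[THEN less_imp_neq, symmetric])
    qed
    then show "((?F \<circ> real_of_ereal) \<longlongrightarrow> - ln x) (at_left \<infinity>)"
      by (simp add: ereal_tendsto_simps1)
  qed auto
  then show ?thesis
    by simp
qed

text \<open>With v = w(x) / x the derivative of v is - ((a b)^2 - x^4) / (x^2 w(x)), which accounts
  for the numerator of the kernel and for the division by w. What remains is - y / (y^2 v^2 + D^2)
  dv, with an arctangent as antiderivative.\<close>

lemma nn_integral_elliptic_kernel:
  fixes a b y :: real
  assumes "0 < b" "b < a" "0 < y"
  shows "(\<integral>\<^sup>+x\<in>{0<..<b}. ennreal (((a * b)\<^sup>2 - x ^ 4) * y / ((x\<^sup>2 + y\<^sup>2) * (x\<^sup>2 * y\<^sup>2 + (a * b)\<^sup>2))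
            / sqrt ((a\<^sup>2 - x\<^sup>2) * (b\<^sup>2 - x\<^sup>2))) \<partial>lborel)
         = ennreal (pi / 2 / sqrt ((a\<^sup>2 + y\<^sup>2) * (b\<^sup>2 + y\<^sup>2)))"
proof -
  define D where "D = sqrt ((a\<^sup>2 + y\<^sup>2) * (b\<^sup>2 + y\<^sup>2))"
  have D: "0 < D" "D\<^sup>2 = (a\<^sup>2 + y\<^sup>2) * (b\<^sup>2 + y\<^sup>2)"
    unfolding D_def using assms by (auto intro!: mult_pos_pos add_pos_nonneg)
  define w where "w x = sqrt ((a\<^sup>2 - x\<^sup>2) * (b\<^sup>2 - x\<^sup>2))" for x
  \<comment> \<open>As x runs from 0 to b, v falls from infinity to 0, so \<open>F\<close> rises
    from - pi / (2 D) to 0.\<close>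
  define F where "F x = (- 1 / D) * arctan (y / D * (w x / x))" for x
  have w: "0 < w x" "(w x)\<^sup>2 = (a\<^sup>2 - x\<^sup>2) * (b\<^sup>2 - x\<^sup>2)" "x\<^sup>2 < a\<^sup>2" "x\<^sup>2 < b\<^sup>2" "x ^ 4 \<le> (a * b)\<^sup>2"
    if x: "0 < x" "x < b" for x
  proof -
    show *: "x\<^sup>2 < a\<^sup>2" "x\<^sup>2 < b\<^sup>2"
      using x assms by (auto intro!: power_strict_mono)
    then show "0 < w x" "(w x)\<^sup>2 = (a\<^sup>2 - x\<^sup>2) * (b\<^sup>2 - x\<^sup>2)"
      unfolding w_def by (auto intro!: mult_nonneg_nonneg)
    have "x\<^sup>2 * x\<^sup>2 \<le> a\<^sup>2 * b\<^sup>2"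
      using * by (intro mult_mono) auto
    then show "x ^ 4 \<le> (a * b)\<^sup>2"
      by (simp add: power_numeral_reduce algebra_simps)
  qed
  have "(\<integral>\<^sup>+x\<in>einterval (ereal 0) (ereal b).
          ennreal (((a * b)\<^sup>2 - x ^ 4) * y / ((x\<^sup>2 + y\<^sup>2) * (x\<^sup>2 * y\<^sup>2 + (a * b)\<^sup>2)) / w x) \<partial>lborel)
        = ennreal (0 - (- (pi / 2) / D))"
  proof (rule nn_integral_FTC_einterval[where F = F])
    fix x assume "ereal 0 < ereal x" "ereal x < ereal b"
    then have x: "0 < x" "x < b" by auto
    note wx = w[OF x]
    have pos: "0 < x\<^sup>2 + y\<^sup>2" "0 < x\<^sup>2 * y\<^sup>2 + (a * b)\<^sup>2"
      using x assms by (auto intro!: add_pos_nonneg)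
    let ?N = "(- (2 * x)) * (b\<^sup>2 - x\<^sup>2) + (a\<^sup>2 - x\<^sup>2) * (- (2 * x))"
    have "((\<lambda>x. (a\<^sup>2 - x\<^sup>2) * (b\<^sup>2 - x\<^sup>2)) has_real_derivative ?N) (at x)"
      by (auto intro!: derivative_eq_intros)
    then have "(w has_real_derivative inverse (sqrt ((a\<^sup>2 - x\<^sup>2) * (b\<^sup>2 - x\<^sup>2))) / 2 * ?N) (at x)"
      unfolding w_def [abs_def] using wx
      by (intro DERIV_chain2[OF DERIV_real_sqrt] mult_pos_pos) auto
    from DERIV_divide[OF this DERIV_ident]
    have "((\<lambda>x. w x / x) has_real_derivative - (((a * b)\<^sup>2 - x ^ 4) / (x\<^sup>2 * w x))) (at x)"
    proof (rule DERIV_cong)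
      \<comment> \<open>The numerator of the quotient rule with the root abstracted to
        \<open>v\<close>; only a polynomial identity without roots is left to check.\<close>
      have 0: "inverse v / 2 * n * x - v = - (q / v)" if "n * x - 2 * v\<^sup>2 = - 2 * q" "v \<noteq> 0"
        for n q v :: real
        using that by (simp add: divide_simps) (simp add: algebra_simps power2_eq_square)
      have "?N * x - 2 * (w x)\<^sup>2 = - 2 * ((a * b)\<^sup>2 - x ^ 4)"
        unfolding wx(2) by algebra
      then have "inverse (w x) / 2 * ?N * x - w x = - (((a * b)\<^sup>2 - x ^ 4) / w x)"
        using wx(1) by (intro 0) auto
      then show "(inverse (sqrt ((a\<^sup>2 - x\<^sup>2) * (b\<^sup>2 - x\<^sup>2))) / 2 * ?N * x - w x * 1) / (x * x)
          = - (((a * b)\<^sup>2 - x ^ 4) / (x\<^sup>2 * w x))"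
        unfolding w_def[symmetric] by (simp add: power2_eq_square)
    qed (use x in simp)
    then have "(F has_real_derivative (- 1 / D) * (inverse (1 + (y / D * (w x / x))\<^sup>2) *
        (y / D * - (((a * b)\<^sup>2 - x ^ 4) / (x\<^sup>2 * w x))))) (at x)"
      unfolding F_def by (intro DERIV_cmult DERIV_chain2[OF DERIV_arctan])
    then show "(F has_real_derivative
        ((a * b)\<^sup>2 - x ^ 4) * y / ((x\<^sup>2 + y\<^sup>2) * (x\<^sup>2 * y\<^sup>2 + (a * b)\<^sup>2)) / w x) (at x)"
    proof (rule DERIV_cong)
      \<comment> \<open>The terms with a^2 + b^2 cancel on the right and the rest factors. This is
        why p = a b is the right constant in the kernel: its denominator becomes x^2 (D^2 + y^2
        v^2).\<close>
      have "(x\<^sup>2 + y\<^sup>2) * (x\<^sup>2 * y\<^sup>2 + (a * b)\<^sup>2) = (x * D)\<^sup>2 + (y * w x)\<^sup>2"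
        unfolding power_mult_distrib D(2) wx(2) by algebra
      then have 1: "1 + (y / D * (w x / x))\<^sup>2
          = (x\<^sup>2 + y\<^sup>2) * (x\<^sup>2 * y\<^sup>2 + (a * b)\<^sup>2) / (x * D)\<^sup>2"
        using x D(1) by (simp add: power_divide add_divide_distrib mult.commute)
      have 2: "(- 1 / D) * (inverse (P / (x * D)\<^sup>2) * (y / D * - (q / (x\<^sup>2 * v)))) = q * y / P / v"
        for P q v :: real
        using x D(1) by (simp add: divide_simps power2_eq_square)
      show "(- 1 / D) * (inverse (1 + (y / D * (w x / x))\<^sup>2) *
          (y / D * - (((a * b)\<^sup>2 - x ^ 4) / (x\<^sup>2 * w x))))
          = ((a * b)\<^sup>2 - x ^ 4) * y / ((x\<^sup>2 + y\<^sup>2) * (x\<^sup>2 * y\<^sup>2 + (a * b)\<^sup>2)) / w x"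
        unfolding 1 by (rule 2)
    qed
    show "isCont (\<lambda>x. ((a * b)\<^sup>2 - x ^ 4) * y / ((x\<^sup>2 + y\<^sup>2) * (x\<^sup>2 * y\<^sup>2 + (a * b)\<^sup>2)) / w x) x"
      using pos wx(1) unfolding w_def by (intro continuous_intros) auto
    show "0 \<le> ((a * b)\<^sup>2 - x ^ 4) * y / ((x\<^sup>2 + y\<^sup>2) * (x\<^sup>2 * y\<^sup>2 + (a * b)\<^sup>2)) / w x"
      using pos wx \<open>0 < y\<close> by simp
  next
    \<comment> \<open>Division by zero makes \<open>F 0\<close> equal to 0, which is not the limit
      of \<open>F\<close> at 0; the limit comes from v tending to infinity.\<close>
    have "filterlim (\<lambda>x. w x / x) at_top (at_right 0)"
    proof (rule LIM_at_top_divide)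
      show "(w \<longlongrightarrow> w 0) (at_right 0)"
        unfolding w_def [abs_def] by (auto intro!: tendsto_eq_intros)
      show "0 < w 0"
        using assms by (simp add: w_def)
      show "((\<lambda>x. x) \<longlongrightarrow> (0::real)) (at_right 0)"
        by (rule tendsto_ident_at)
      show "\<forall>\<^sub>F x in at_right 0. (0::real) < x"
        by (simp add: eventually_at_right_less)
    qed
    then have "filterlim (\<lambda>x. y / D * (w x / x)) at_top (at_right 0)"
      using \<open>0 < y\<close> D(1)
      by (intro filterlim_tendsto_pos_mult_at_top[OF tendsto_const]) auto
    from filterlim_compose[OF tendsto_arctan_at_top this]
    have "(F \<longlongrightarrow> (- 1 / D) * (pi / 2)) (at_right 0)"
      unfolding F_def by (intro tendsto_mult tendsto_const)
    then have "(F \<longlongrightarrow> - (pi / 2) / D) (at_right 0)"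
      by (simp add: mult.commute)
    then show "((F \<circ> real_of_ereal) \<longlongrightarrow> - (pi / 2) / D) (at_right (ereal 0))"
      by (simp add: ereal_tendsto_simps1)
  next
    \<comment> \<open>The integrand blows up at b, but its antiderivative is continuous there, and
      \<open>w b = 0\<close>.\<close>
    have "isCont F b"
      unfolding F_def w_def using assms D(1) by (intro continuous_intros) auto
    then have "(F \<longlongrightarrow> F b) (at_left b)"
      by (auto simp: isCont_def intro: tendsto_within_subset)
    moreover have "F b = 0"
      by (simp add: F_def w_def)
    ultimately show "((F \<circ> real_of_ereal) \<longlongrightarrow> 0) (at_left (ereal b))"
      by (simp add: ereal_tendsto_simps1)
  qed (use assms in auto)
  then show ?thesis
    by (simp add: w_def D_def)
qed

section \<open>Exchange of the order of integration, and the evaluation\<close>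

lemma nn_integral_ln_elliptic:
  fixes a b :: real
  assumes "0 < b" "b < a"
  shows "(\<integral>\<^sup>+x\<in>{0<..<b}. ennreal ((ln (a * b) - 2 * ln x) / sqrt ((a\<^sup>2 - x\<^sup>2) * (b\<^sup>2 - x\<^sup>2))) \<partial>lborel)
         = ennreal (pi / 2 * (elliptic_K (sqrt (a\<^sup>2 - b\<^sup>2) / a) / a))"
proof -
  define q where "q x y = ((a * b)\<^sup>2 - x ^ 4) * y / ((x\<^sup>2 + y\<^sup>2) * (x\<^sup>2 * y\<^sup>2 + (a * b)\<^sup>2))" for x y
  define w where "w x = sqrt ((a\<^sup>2 - x\<^sup>2) * (b\<^sup>2 - x\<^sup>2))" for x
  have [measurable]: "(\<lambda>z. q (fst z) (snd z)) \<in> borel_measurable (lborel \<Otimes>\<^sub>M lborel)"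
    "w \<in> borel_measurable borel" "q x \<in> borel_measurable borel" for x
    unfolding q_def [abs_def] w_def [abs_def] by measurable
  have w: "0 < w x" if "0 < x" "x < b" for x
  proof -
    have "x\<^sup>2 < b\<^sup>2" "b\<^sup>2 < a\<^sup>2"
      using that assms by (auto intro!: power_strict_mono)
    then show ?thesis
      by (auto simp: w_def intro!: mult_pos_pos)
  qed
  \<comment> \<open>Both domains are encoded by indicators, so that the iterated integrals run over
    the whole line and joint measurability suffices for Tonelli.\<close>
  have "(\<integral>\<^sup>+x\<in>{0<..<b}. ennreal ((ln (a * b) - 2 * ln x) / w x) \<partial>lborel)
      = (\<integral>\<^sup>+x. (\<integral>\<^sup>+y. ennreal (q x y / w x) * indicator {0<..<b} x * indicator {0<..} y \<partial>lborel) \<partial>lborel)"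
  proof (intro nn_integral_cong)
    fix x :: real
    show "ennreal ((ln (a * b) - 2 * ln x) / w x) * indicator {0<..<b} x
        = (\<integral>\<^sup>+y. ennreal (q x y / w x) * indicator {0<..<b} x * indicator {0<..} y \<partial>lborel)"
    proof (cases "0 < x \<and> x < b")
      case True
      then have "x\<^sup>2 < a * b"
        using assms mult_strict_mono[of x a x b] by (simp add: power2_eq_square)
      have "ennreal ((ln (a * b) - 2 * ln x) / w x) = ennreal (1 / w x) * ennreal (ln (a * b) - 2 * ln x)"
        using w[of x] True by (simp add: ennreal_mult'[symmetric])
      also have "\<dots> = (\<integral>\<^sup>+y. ennreal (1 / w x) * (ennreal (q x y) * indicator {0<..} y) \<partial>lborel)"
        using nn_integral_log_kernel[OF _ \<open>x\<^sup>2 < a * b\<close>] True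
        by (subst nn_integral_cmult) (auto simp: q_def)
      also have "\<dots> = (\<integral>\<^sup>+y. ennreal (q x y / w x) * indicator {0<..} y \<partial>lborel)"
        using w[of x] True by (simp add: ennreal_mult'[symmetric] mult.assoc[symmetric])
      finally show ?thesis
        using True by simp
    qed auto
  qed
  also have "\<dots> = (\<integral>\<^sup>+y. (\<integral>\<^sup>+x. ennreal (q x y / w x) * indicator {0<..<b} x * indicator {0<..} y \<partial>lborel) \<partial>lborel)"
    by (rule lborel_pair.Fubini'[symmetric]) (simp add: case_prod_unfold)
  also have "\<dots> = (\<integral>\<^sup>+y. ennreal (pi / 2) * (ennreal (1 / sqrt ((a\<^sup>2 + y\<^sup>2) * (b\<^sup>2 + y\<^sup>2)))
      * indicator {0<..} y) \<partial>lborel)"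
  proof (intro nn_integral_cong)
    fix y :: real
    show "(\<integral>\<^sup>+x. ennreal (q x y / w x) * indicator {0<..<b} x * indicator {0<..} y \<partial>lborel)
        = ennreal (pi / 2) * (ennreal (1 / sqrt ((a\<^sup>2 + y\<^sup>2) * (b\<^sup>2 + y\<^sup>2))) * indicator {0<..} y)"
      using nn_integral_elliptic_kernel[OF assms, of y]
      by (cases "0 < y") (auto simp: q_def w_def ennreal_mult'[symmetric])
  qed
  also have "\<dots> = ennreal (pi / 2) * ennreal (elliptic_K (sqrt (a\<^sup>2 - b\<^sup>2) / a) / a)"
    by (subst nn_integral_cmult) (auto simp: nn_integral_elliptic_K_complementary[OF assms])
  also have "\<dots> = ennreal (pi / 2 * (elliptic_K (sqrt (a\<^sup>2 - b\<^sup>2) / a) / a))"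
    by (simp add: ennreal_mult'[symmetric])
  finally show ?thesis
    by (simp add: w_def)
qed

theorem theorem4p1:
  fixes a b :: real
  assumes "0 < b" and "b < a"
  shows "((\<lambda>x. ln x / sqrt ((a\<^sup>2 - x\<^sup>2) * (b\<^sup>2 - x\<^sup>2))) has_integral
           1 / (2 * a) * (elliptic_K (b / a) * ln (a * b)
                          - pi / 2 * elliptic_K (sqrt (a\<^sup>2 - b\<^sup>2) / a))) {0<..<b}"
proof -
  let ?w = "\<lambda>x. sqrt ((a\<^sup>2 - x\<^sup>2) * (b\<^sup>2 - x\<^sup>2))"
  let ?K' = "elliptic_K (sqrt (a\<^sup>2 - b\<^sup>2) / a)"
  have "\<bar>sqrt (a\<^sup>2 - b\<^sup>2) / a\<bar> < 1"
    using assms real_sqrt_less_mono[of "a\<^sup>2 - b\<^sup>2" "a\<^sup>2"] power_strict_mono[of b a 2] by simp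
  then have "0 \<le> ?K'"
    by (rule nn_integral_elliptic_K(2))
  \<comment> \<open>The sign of ln x may change on (0, b), whereas ln (a b) - 2 ln x is nonnegative
    because x < a and x < b; so the nonnegative integral is used for this combination.\<close>
  have "((\<lambda>x. (ln (a * b) - 2 * ln x) / ?w x) has_integral pi / 2 * (?K' / a)) {0<..<b}"
  proof (rule has_integral_nn_integral)
    fix x assume x: "x \<in> {0<..<b}"
    then have "x\<^sup>2 < b\<^sup>2" "b\<^sup>2 < a\<^sup>2"
      using assms by (auto intro!: power_strict_mono)
    then have "0 \<le> ?w x"
      by simp
    moreover have "ln x \<le> ln a" "ln x \<le> ln b"
      using x assms by auto
    then have "0 \<le> ln (a * b) - 2 * ln x"
      using assms by (simp add: ln_mult)
    ultimately show "0 \<le> (ln (a * b) - 2 * ln x) / ?w x"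
      by simp
  qed (use assms \<open>0 \<le> ?K'\<close> nn_integral_ln_elliptic[OF assms] in auto)
  \<comment> \<open>Now ln x is recovered as half of ln (a b) - (ln (a b) - 2 ln x); the constant ln
    (a b) contributes the multiple of \<open>elliptic_K (b / a)\<close>.\<close>
  from has_integral_diff[OF
      has_integral_mult_right[OF has_integral_elliptic_K_scaled[OF assms], of "ln (a * b)"] this]
  have "((\<lambda>x. 1 / 2 * (ln (a * b) * (1 / ?w x) - (ln (a * b) - 2 * ln x) / ?w x)) has_integral
      1 / 2 * (ln (a * b) * (elliptic_K (b / a) / a) - pi / 2 * (?K' / a))) {0<..<b}"
    by (rule has_integral_mult_right)
  \<comment> \<open>Also true for \<open>v = 0\<close>, where both sides are 0, so it rewrites the
    integrand without a side condition.\<close>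
  moreover have "1 / 2 * (ln (a * b) * (1 / v) - (ln (a * b) - 2 * l) / v) = l / v" for l v :: real
    by (simp add: diff_divide_distrib)
  moreover have "1 / 2 * (ln (a * b) * (elliptic_K (b / a) / a) - pi / 2 * (?K' / a))
      = 1 / (2 * a) * (elliptic_K (b / a) * ln (a * b) - pi / 2 * ?K')"
    using assms by (simp add: field_simps)
  ultimately show ?thesis
    by (simp only:)
qed

end
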